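(* Let $k\ge 2$, let $G$ be an equitably $k$-colorable graph on $n$ vertices, and let $H$ be a $(k-1)$-partite graph. If $k$ divides $n$, then for every integer $l\ge 1$, $\chi_{=}(G\circ^l H)\le k$.
   Context: All graphs are finite, simple and connected. A graph is $r$-partite if its vertex set can be partitioned into $r$ independent sets. A graph is equitably $k$-colorable if its vertex set can be partitioned into $k$ (possibly empty) independent sets $V_1,\dots,V_k$ with $||V_i|-|V_j||\le 1$ for all $i,j$; $\chi_{=}(G)$ is the least $k$ for which $G$ is equitably $k$-colorable. The corona $G\circ H$ is formed from one copy of $G$ and $|V(G)|$ copies of $H$, the $i$-th vertex of $G$ being joined to every vertex of the $i$-th copy of $H$; $G\circ^1 H=G\circ H$ and $G\circ^l H=(G\circ^{l-1}H)\circ H$ for $l\ge 2$. *)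

theory Defs
  imports "Graph_Theory.Graph_Theory" "HOL-Library.Disjoint_Sets"
begin

text \<open>Finite simple graphs are \<open>pair_graph\<close>s: finite, loop-free digraphs without parallel arcs
  whose arc relation is symmetric. The library's \<open>connected\<close> excludes the null graph.\<close>

definition independent_set :: "'a pair_pre_digraph \<Rightarrow> 'a set \<Rightarrow> bool" where
  "independent_set G S \<longleftrightarrow> S \<subseteq> pverts G \<and> (\<forall>u\<in>S. \<forall>v\<in>S. (u, v) \<notin> parcs G)"

text \<open>The classes \<open>V 0, \<dots>, V (r - 1)\<close> may be empty.\<close>

definition independent_partition :: "'a pair_pre_digraph \<Rightarrow> nat \<Rightarrow> (nat \<Rightarrow> 'a set) \<Rightarrow> bool" where
  "independent_partition G r V \<longleftrightarrow>
     (\<Union>i<r. V i) = pverts G \<and> disjoint_family_on V {..<r} \<and> (\<forall>i<r. independent_set G (V i))"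

definition partite :: "nat \<Rightarrow> 'a pair_pre_digraph \<Rightarrow> bool" where
  "partite r G \<longleftrightarrow> (\<exists>V. independent_partition G r V)"

definition equitably_colorable :: "nat \<Rightarrow> 'a pair_pre_digraph \<Rightarrow> bool" where
  "equitably_colorable k G \<longleftrightarrow>
     (\<exists>V. independent_partition G k V \<and>
          (\<forall>i<k. \<forall>j<k. \<bar>int (card (V i)) - int (card (V j))\<bar> \<le> 1))"

definition equitable_chromatic_number :: "'a pair_pre_digraph \<Rightarrow> nat" where
  "equitable_chromatic_number G = (LEAST k. equitably_colorable k G)"

text \<open>\<open>Inl v\<close> is the vertex \<open>v\<close> of \<open>G\<close>; \<open>Inr (v, h)\<close> is the vertex \<open>h\<close> of the copy of \<open>H\<close>
  attached to \<open>v\<close>.\<close>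

definition corona ::
  "'a pair_pre_digraph \<Rightarrow> 'b pair_pre_digraph \<Rightarrow> ('a + 'a \<times> 'b) pair_pre_digraph" where
  "corona G H =
     \<lparr> pverts = Inl ` pverts G \<union> Inr ` (pverts G \<times> pverts H),
       parcs = {(Inl u, Inl v) | u v. (u, v) \<in> parcs G}
             \<union> {(Inr (v, h), Inr (v, h')) | v h h'. v \<in> pverts G \<and> (h, h') \<in> parcs H}
             \<union> {(Inl v, Inr (v, h)) | v h. v \<in> pverts G \<and> h \<in> pverts H}
             \<union> {(Inr (v, h), Inl v) | v h. v \<in> pverts G \<and> h \<in> pverts H} \<rparr>"

definition relabel :: "('a \<Rightarrow> 'b) \<Rightarrow> 'a pair_pre_digraph \<Rightarrow> 'b pair_pre_digraph" where
  "relabel f G = \<lparr> pverts = f ` pverts G, parcs = map_prod f f ` parcs G \<rparr>"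

text \<open>The vertex type of the corona grows with each iteration, so the iterated corona is relabelled
  injectively into one type: \<open>(v, xs)\<close> stems from the vertex \<open>v\<close> of \<open>G\<close>, and \<open>xs\<close> records,
  latest step first, whether that step kept the vertex reached so far (\<open>None\<close>) or moved to the vertex
  \<open>h\<close> of the copy of \<open>H\<close> attached to it (\<open>Some h\<close>).\<close>

fun corona_label :: "('a \<times> 'b option list) + ('a \<times> 'b option list) \<times> 'b \<Rightarrow> 'a \<times> 'b option list"
where
  "corona_label (Inl (v, xs)) = (v, None # xs)"
| "corona_label (Inr ((v, xs), h)) = (v, Some h # xs)"

primrec iterated_corona ::
  "'a pair_pre_digraph \<Rightarrow> nat \<Rightarrow> 'b pair_pre_digraph \<Rightarrow> ('a \<times> 'b option list) pair_pre_digraph"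
where
  "iterated_corona G 0 H = relabel (\<lambda>v. (v, [])) G"
| "iterated_corona G (Suc l) H = relabel corona_label (corona (iterated_corona G l H) H)"

lemma inj_corona_label: "inj corona_label"
proof (rule injI)
  fix x y :: "('a \<times> 'b option list) + ('a \<times> 'b option list) \<times> 'b"
  assume "corona_label x = corona_label y"
  then show "x = y"
    by (cases x rule: corona_label.cases; cases y rule: corona_label.cases) auto
qed

lemma pair_graph_corona:
  assumes "pair_graph G" "pair_graph H"
  shows "pair_graph (corona G H)"
proof -
  interpret G: pair_graph G by fact
  interpret H: pair_graph H by fact
  have sG: "(v, u) \<in> parcs G" if "(u, v) \<in> parcs G" for u v
    using G.pair_sym_arcs that by (auto simp: symmetric_def dest: symD)
  have sH: "(v, u) \<in> parcs H" if "(u, v) \<in> parcs H" for u v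
    using H.pair_sym_arcs that by (auto simp: symmetric_def dest: symD)
  have wf: "parcs (corona G H) \<subseteq> pverts (corona G H) \<times> pverts (corona G H)"
    by (auto simp: corona_def dest: G.wellformed' H.wellformed')
  have fin: "finite (pverts (corona G H))"
    by (auto simp: corona_def G.pair_finite_verts H.pair_finite_verts)
  show ?thesis
  proof
    show "finite (parcs (corona G H))"
      using finite_subset[OF wf] fin by blast
    show "symmetric (with_proj (corona G H))"
      unfolding symmetric_def by (rule symI) (auto simp: corona_def sG sH)
    show "fst e \<noteq> snd e" if "e \<in> parcs (corona G H)" for e
      using that by (auto simp: corona_def dest: G.pair_no_loops H.pair_no_loops)
  qed (use wf fin in auto)
qed

lemma pair_graph_relabel:
  assumes "pair_graph G" "inj f"
  shows "pair_graph (relabel f G)"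
proof -
  interpret G: pair_graph G by fact
  have sG: "(v, u) \<in> parcs G" if "(u, v) \<in> parcs G" for u v
    using G.pair_sym_arcs that by (auto simp: symmetric_def dest: symD)
  show ?thesis
  proof
    show "symmetric (with_proj (relabel f G))"
      unfolding symmetric_def by (rule symI) (force simp: relabel_def dest: sG)
    show "fst e \<noteq> snd e" if "e \<in> parcs (relabel f G)" for e
      using that G.pair_no_loops injD[OF \<open>inj f\<close>] by (fastforce simp: relabel_def)
  qed (auto simp: relabel_def G.pair_finite_verts G.pair_finite_arcs dest: G.wellformed')
qed

lemma pair_graph_iterated_corona:
  assumes "pair_graph G" "pair_graph H"
  shows "pair_graph (iterated_corona G l H)"
  by (induction l)
     (auto intro!: pair_graph_relabel pair_graph_corona assms inj_corona_label injI)

text \<open>Singleton classes give an equitable coloring, so the \<open>LEAST\<close> above is attained.\<close>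

lemma equitably_colorable_card:
  assumes "pair_graph G"
  shows "equitably_colorable (card (pverts G)) G"
proof -
  interpret G: pair_graph G by fact
  obtain f where f: "bij_betw f {..<card (pverts G)} (pverts G)"
    using ex_bij_betw_nat_finite[OF G.pair_finite_verts] by (auto simp: atLeast0LessThan)
  have "independent_partition G (card (pverts G)) (\<lambda>i. {f i})"
    using f G.pair_no_loops
    by (fastforce simp: independent_partition_def independent_set_def disjoint_family_on_def
        bij_betw_def inj_on_def)
  then show ?thesis
    unfolding equitably_colorable_def by (intro exI[of _ "\<lambda>i. {f i}"]) simp
qed

end

theory Submission
  imports Defs
begin

text \<open>An equitable \<open>k\<close>-coloring of a graph whose order is a multiple of \<open>k\<close> has classes of one common
  size \<open>m\<close>. Color the copy of \<open>H\<close> at \<open>v\<close> by shifting a fixed \<open>(k - 1)\<close>-coloring \<open>d\<close> of \<open>H\<close> cyclically: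
  \<open>h\<close> receives \<open>c v + 1 + d h\<close> modulo \<open>k\<close>, which avoids \<open>c v\<close>. For fixed \<open>h\<close> this is a cyclic
  shift of \<open>c\<close>, so the vertices \<open>h\<close> of all copies together add exactly \<open>m\<close> vertices to each class.
  Hence the corona has classes of common size \<open>m (1 + |H|)\<close>, and the step can be iterated.\<close>

definition proper_coloring :: "nat \<Rightarrow> 'a pair_pre_digraph \<Rightarrow> ('a \<Rightarrow> nat) \<Rightarrow> bool" where
  "proper_coloring k G c \<longleftrightarrow>
     (\<forall>v\<in>pverts G. c v < k) \<and> (\<forall>(u, v)\<in>parcs G. c u \<noteq> c v)"

text \<open>Exact equality of class sizes is the invariant of the iteration: class sizes differing
  by one could drift further apart as the copies of \<open>H\<close> are added.\<close>

definition balanced_coloring :: "nat \<Rightarrow> nat \<Rightarrow> 'a pair_pre_digraph \<Rightarrow> ('a \<Rightarrow> nat) \<Rightarrow> bool" where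
  "balanced_coloring k m G c \<longleftrightarrow>
     proper_coloring k G c \<and> (\<forall>i<k. card {v \<in> pverts G. c v = i} = m)"

text \<open>Color values, unlike indexed sets, can be shifted arithmetically. Disjointness makes the
  class of a vertex unique, so the chosen \<open>c\<close> recovers each \<open>V i\<close> exactly
  and class sizes carry over.\<close>

lemma proper_coloring_of_independent_partition:
  assumes "pair_graph G" "independent_partition G k V"
  obtains c where "proper_coloring k G c" "\<And>i. i < k \<Longrightarrow> {v \<in> pverts G. c v = i} = V i"
proof -
  interpret G: pair_graph G by fact
  have un: "(\<Union>i<k. V i) = pverts G"
    and disj: "\<And>i j. i < k \<Longrightarrow> j < k \<Longrightarrow> i \<noteq> j \<Longrightarrow> V i \<inter> V j = {}"
    and ind: "\<And>i u v. i < k \<Longrightarrow> u \<in> V i \<Longrightarrow> v \<in> V i \<Longrightarrow> (u, v) \<notin> parcs G"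
    using assms(2)
    by (auto simp: independent_partition_def disjoint_family_on_def independent_set_def)
  have "\<forall>v\<in>pverts G. \<exists>i<k. v \<in> V i"
    using un by blast
  then obtain c where c: "\<And>v. v \<in> pverts G \<Longrightarrow> c v < k \<and> v \<in> V (c v)"
    by metis
  have classes: "{v \<in> pverts G. c v = i} = V i" if "i < k" for i
  proof
    show "{v \<in> pverts G. c v = i} \<subseteq> V i"
      using c by auto
    show "V i \<subseteq> {v \<in> pverts G. c v = i}"
    proof
      fix v assume v: "v \<in> V i"
      then have "v \<in> pverts G"
        using un that by blast
      with v c[of v] disj[of i "c v"] that show "v \<in> {v \<in> pverts G. c v = i}"
        by blast
    qed
  qed
  have "proper_coloring k G c"
    unfolding proper_coloring_def
  proof (intro conjI ballI, goal_cases)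
    case (1 v)
    then show ?case using c by blast
  next
    case (2 e)
    then obtain u v where e: "e = (u, v)" "u \<in> pverts G" "v \<in> pverts G" "(u, v) \<in> parcs G"
      by (metis G.wellformed' prod.exhaust)
    have "c u \<noteq> c v"
      using c[of u] c[of v] ind[of "c u" u v] e by metis
    with e show ?case by simp
  qed
  with classes show thesis
    using that by blast
qed

text \<open>A value below \<open>q\<close> keeps all others at most \<open>q\<close>, so the sum
  drops strictly below \<open>k * q\<close>; a value above \<open>q\<close> is excluded
  symmetrically.\<close>

lemma balanced_nat_family_constant:
  fixes f :: "nat \<Rightarrow> nat"
  assumes sum: "(\<Sum>i<k. f i) = k * q"
    and close: "\<And>i j. i < k \<Longrightarrow> j < k \<Longrightarrow> \<bar>int (f i) - int (f j)\<bar> \<le> 1"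
    and "i < k"
  shows "f i = q"
proof (rule ccontr)
  assume "f i \<noteq> q"
  then consider "f i < q" | "q < f i"
    by linarith
  then show False
  proof cases
    case 1
    have "(\<Sum>j<k. f j) < (\<Sum>j<k. q)"
    proof (rule sum_strict_mono_ex1)
      show "\<forall>j\<in>{..<k}. f j \<le> q"
        using close[of _ i] 1 \<open>i < k\<close> by fastforce
    qed (use 1 \<open>i < k\<close> in auto)
    with sum show False by simp
  next
    case 2
    have "(\<Sum>j<k. q) < (\<Sum>j<k. f j)"
    proof (rule sum_strict_mono_ex1)
      show "\<forall>j\<in>{..<k}. q \<le> f j"
        using close[of i] 2 \<open>i < k\<close> by fastforce
    qed (use 2 \<open>i < k\<close> in auto)
    with sum show False by simp
  qed
qed

lemma balanced_coloring_of_equitably_colorable: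
  assumes "pair_graph G" "equitably_colorable k G" "card (pverts G) = k * q"
  obtains c where "balanced_coloring k q G c"
proof -
  interpret G: pair_graph G by fact
  obtain V where V: "independent_partition G k V"
    and close: "\<And>i j. i < k \<Longrightarrow> j < k \<Longrightarrow> \<bar>int (card (V i)) - int (card (V j))\<bar> \<le> 1"
    using assms(2) unfolding equitably_colorable_def by blast
  have un: "(\<Union>i<k. V i) = pverts G" and disj: "disjoint_family_on V {..<k}"
    using V by (auto simp: independent_partition_def)
  have "finite (V i)" if "i < k" for i
    using un that by (intro finite_subset[OF _ G.pair_finite_verts]) blast
  then have "card (\<Union>i<k. V i) = (\<Sum>i<k. card (V i))"
    using disj by (intro card_UN_disjoint) (auto simp: disjoint_family_on_def)
  then have "(\<Sum>i<k. card (V i)) = k * q"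
    using un assms(3) by simp
  then have "card (V i) = q" if "i < k" for i
    using balanced_nat_family_constant[of "\<lambda>i. card (V i)"] close that by blast
  moreover obtain c where "proper_coloring k G c" "\<And>i. i < k \<Longrightarrow> {v \<in> pverts G. c v = i} = V i"
    using proper_coloring_of_independent_partition[OF assms(1) V] by blast
  ultimately have "balanced_coloring k q G c"
    by (simp add: balanced_coloring_def)
  then show thesis
    by (rule that)
qed

lemma equitably_colorable_of_balanced_coloring:
  assumes "balanced_coloring k m G c"
  shows "equitably_colorable k G"
  unfolding equitably_colorable_def
proof (intro exI[of _ "\<lambda>i. {v \<in> pverts G. c v = i}"] conjI)
  show "independent_partition G k (\<lambda>i. {v \<in> pverts G. c v = i})"
    using assms
    by (fastforce simp: balanced_coloring_def proper_coloring_def independent_partition_def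
        disjoint_family_on_def independent_set_def)
qed (use assms in \<open>auto simp: balanced_coloring_def\<close>)

text \<open>As \<open>inv f\<close> undoes the injective \<open>f\<close>, each color class is the
  \<open>f\<close>-image of an old one and keeps its size.\<close>

lemma balanced_coloring_relabel:
  assumes "inj f" "balanced_coloring k m G c"
  shows "balanced_coloring k m (relabel f G) (c \<circ> inv f)"
proof -
  have "{v \<in> f ` pverts G. (c \<circ> inv f) v = i} = f ` {v \<in> pverts G. c v = i}" for i
    using assms(1) by auto
  then have "card {v \<in> f ` pverts G. (c \<circ> inv f) v = i} = card {v \<in> pverts G. c v = i}" for i
    by (simp only: card_image[OF inj_on_subset[OF assms(1) subset_UNIV]])
  then show ?thesis
    using assms by (fastforce simp: balanced_coloring_def proper_coloring_def relabel_def)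
qed

text \<open>Subtraction of \<open>b\<close> modulo \<open>k\<close>, written as adding
  \<open>k - b\<close> to avoid truncation. It turns a class of a shifted coloring into a class of
  the original one.\<close>

lemma add_mod_eq_iff:
  fixes a b k i :: nat
  assumes "a < k" "b < k" "i < k"
  shows "(a + b) mod k = i \<longleftrightarrow> a = (i + (k - b)) mod k"
  using assms by (auto simp: mod_if)

fun corona_coloring :: "nat \<Rightarrow> ('a \<Rightarrow> nat) \<Rightarrow> ('b \<Rightarrow> nat) \<Rightarrow> 'a + 'a \<times> 'b \<Rightarrow> nat" where
  "corona_coloring k c d (Inl v) = c v"
| "corona_coloring k c d (Inr (v, h)) = (c v + Suc (d h)) mod k"

lemma proper_coloring_corona:
  assumes "proper_coloring k G c" "proper_coloring (k - 1) H d" "pair_graph H"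
  shows "proper_coloring k (corona G H) (corona_coloring k c d)"
proof -
  interpret H: pair_graph H by fact
  have c: "c v < k" if "v \<in> pverts G" for v
    using assms(1) that by (auto simp: proper_coloring_def)
  \<comment> \<open>Having only \<open>k - 1\<close> colors on \<open>H\<close> leaves room for the
    \<open>Suc\<close>: the offset lies in 1, ..., \<open>k - 1\<close> and is never 0 modulo
    \<open>k\<close>.\<close>
  have d: "Suc (d h) < k" if "h \<in> pverts H" for h
    using assms(2) that by (fastforce simp: proper_coloring_def)
  have shift: "(c v + Suc (d h)) mod k \<noteq> c v" if "v \<in> pverts G" "h \<in> pverts H" for v h
    using c[OF that(1)] d[OF that(2)] by (auto simp: mod_if)
  \<comment> \<open>Within one copy \<open>c v\<close> is fixed, and distinct offsets below
    \<open>k\<close> stay distinct modulo \<open>k\<close> after adding it.\<close>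
  have copy: "(c v + Suc (d h)) mod k \<noteq> (c v + Suc (d h')) mod k"
    if "v \<in> pverts G" "(h, h') \<in> parcs H" for v h h'
  proof -
    have "d h \<noteq> d h'" "h \<in> pverts H" "h' \<in> pverts H"
      using that assms(2) H.wellformed' by (auto simp: proper_coloring_def)
    then show ?thesis
      using c[OF that(1)] d[of h] d[of h'] by (auto simp: mod_if)
  qed
  show ?thesis
    unfolding proper_coloring_def
  proof (intro conjI ballI)
    show "corona_coloring k c d x < k" if "x \<in> pverts (corona G H)" for x
      using that c by (force simp: corona_def)
    show "case e of (x, y) \<Rightarrow> corona_coloring k c d x \<noteq> corona_coloring k c d y"
      if "e \<in> parcs (corona G H)" for e
    proof -
      have "c u \<noteq> c v" if "(u, v) \<in> parcs G" for u v
        using assms(1) that by (auto simp: proper_coloring_def)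
      with that copy shift shift[symmetric] show ?thesis
        by (auto simp: corona_def simp del: add_Suc_right)
    qed
  qed
qed

lemma balanced_coloring_corona:
  assumes "pair_graph G" "pair_graph H"
    and c: "balanced_coloring k m G c" and d: "proper_coloring (k - 1) H d"
  shows "balanced_coloring k (m + card (pverts H) * m) (corona G H) (corona_coloring k c d)"
proof -
  interpret G: pair_graph G by fact
  interpret H: pair_graph H by fact
  have "card {x \<in> pverts (corona G H). corona_coloring k c d x = i} = m + card (pverts H) * m"
    if i: "i < k" for i
  proof -
    let ?A = "{v \<in> pverts G. c v = i}"
    let ?C = "\<lambda>h. {v \<in> pverts G. (c v + Suc (d h)) mod k = i}"
    \<comment> \<open>The copy vertices of color \<open>i\<close> are grouped by \<open>h\<close>,
      not by \<open>v\<close>: a single copy may meet the classes unevenly, whereas each fixed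
      \<open>h\<close> contributes exactly \<open>m\<close>.\<close>
    let ?B = "\<Union>h\<in>pverts H. (\<lambda>v. (v, h)) ` ?C h"
    have C: "card (?C h) = m" if h: "h \<in> pverts H" for h
    proof -
      have "Suc (d h) < k"
        using d h by (fastforce simp: proper_coloring_def)
      \<comment> \<open>Undoing the shift exhibits \<open>?C h\<close> as a class of
        \<open>c\<close> whose color is again below \<open>k\<close>, hence of size
        \<open>m\<close>.\<close>
      then have "?C h = {v \<in> pverts G. c v = (i + (k - Suc (d h))) mod k}"
        using c i add_mod_eq_iff[of _ k "Suc (d h)" i]
        by (auto simp: balanced_coloring_def proper_coloring_def simp del: add_Suc_right)
      then show ?thesis
        using c i by (simp add: balanced_coloring_def)
    qed
    have "card ?B = (\<Sum>h\<in>pverts H. card ((\<lambda>v. (v, h)) ` ?C h))"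
      by (rule card_UN_disjoint) (auto simp: G.pair_finite_verts H.pair_finite_verts)
    also have "\<dots> = (\<Sum>h\<in>pverts H. m)"
      by (rule sum.cong) (simp_all add: card_image inj_on_def C del: add_Suc_right)
    finally have B: "card ?B = card (pverts H) * m"
      by simp
    have "{x \<in> pverts (corona G H). corona_coloring k c d x = i} = ?A <+> ?B"
      by (auto simp: corona_def simp del: add_Suc_right)
    also have "card \<dots> = card ?A + card ?B"
      by (rule card_Plus) (auto simp: G.pair_finite_verts H.pair_finite_verts)
    also have "card ?A = m"
      using c i by (simp add: balanced_coloring_def)
    finally show ?thesis
      using B by simp
  qed
  moreover have "proper_coloring k (corona G H) (corona_coloring k c d)"
    using c d assms(2) by (intro proper_coloring_corona) (auto simp: balanced_coloring_def)
  ultimately show ?thesis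
    by (simp add: balanced_coloring_def)
qed

text \<open>Each step multiplies the class size by \<open>1 + card (pverts H)\<close>; only the
  existence of a common size \<open>m'\<close> matters for equitability.\<close>

lemma balanced_coloring_iterated_corona:
  assumes "pair_graph G" "pair_graph H"
    and "balanced_coloring k m G c" and "proper_coloring (k - 1) H d"
  shows "\<exists>m' c'. balanced_coloring k m' (iterated_corona G l H) c'"
proof (induction l)
  case 0
  show ?case
    using balanced_coloring_relabel[OF _ assms(3), of "\<lambda>v. (v, [])"]
    by (auto intro!: injI)
next
  case (Suc l)
  then obtain m' c' where "balanced_coloring k m' (iterated_corona G l H) c'"
    by blast
  then show ?case
    using balanced_coloring_relabel[OF inj_corona_label]
      balanced_coloring_corona[OF pair_graph_iterated_corona[OF assms(1,2)] assms(2) _ assms(4)]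
    by fastforce
qed

theorem theorem1:
  fixes G :: "'a pair_pre_digraph" and H :: "'b pair_pre_digraph" and k n l :: nat
  assumes "k \<ge> 2"
    and "pair_graph G" and "Digraph_Component.connected (with_proj G)"
    and "pair_graph H" and "Digraph_Component.connected (with_proj H)"
    and "equitably_colorable k G" and "card (pverts G) = n"
    and "partite (k - 1) H"
    and "k dvd n"
    and "l \<ge> 1"
  shows "equitable_chromatic_number (iterated_corona G l H) \<le> k"
proof -
  \<comment> \<open>Divisibility enters here: the quotient \<open>q\<close> becomes the common class
    size in \<open>G\<close>.\<close>
  obtain q where "card (pverts G) = k * q"
    using assms(7,9) by (auto elim: dvdE)
  then obtain c where c: "balanced_coloring k q G c"
    using balanced_coloring_of_equitably_colorable assms(2,6) by blast
  obtain d where "proper_coloring (k - 1) H d"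
    using assms(4,8) proper_coloring_of_independent_partition unfolding partite_def by blast
  then have "equitably_colorable k (iterated_corona G l H)"
    using balanced_coloring_iterated_corona[OF assms(2,4) c] equitably_colorable_of_balanced_coloring
    by blast
  then show ?thesis
    unfolding equitable_chromatic_number_def by (rule Least_le)
qed

end
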